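(* Let $n\ge 1$ and let $a_1,\dots,a_n>0$ be pairwise commensurable real numbers (i.e. $a_i/a_j\in\mathbb{Q}$ for all $i,j$). Let $\mathcal{T}=[0,a_1]\times\cdots\times[0,a_n]\subset\mathbb{R}^n$. Then for every $v\in\mathcal{T}$, the crossing number satisfies $m_{\mathcal{T}}(v)\in\{0\}\cup\{2^k : k\ge 0 \text{ an integer}\}$.
   Context: A corner of $\mathcal{T}$ is a point $w$ with $w_i\in\{0,a_i\}$ for all $i$. The billiard trajectory is the curve $\gamma$ starting at the origin with direction $d=(1,\dots,1)$, moving in a straight line; whenever it reaches the boundary hyperplane $x_i=0$ or $x_i=a_i$, the $i$-th component of its current direction is negated (elastic reflection; several components are negated simultaneously if several such hyperplanes are reached at once), and the motion stops when it reaches a corner (other than the starting origin). Under the commensurability hypothesis the trajectory has finite length and ends at a corner. Parametrize $\gamma:[0,L]\to\mathcal{T}$ so that on each linear piece $\gamma'(t)\in\{-1,1\}^n$. The crossing number $m_{\mathcal{T}}(v)$ of a point $v\in\mathcal{T}$ is the number of parameters $t\in[0,L]$ with $\gamma(t)=v$ (so the starting corner and the end corner each have crossing number $1$, and all other corners have crossing number $0$). *)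

theory Defs
  imports "HOL-Analysis.Analysis" "HOL-Library.Extended_Nat"
begin

text \<open>
  The billiard table with side lengths \<open>a\<close> is \<open>cbox 0 a\<close>, that is, the product of the
  intervals \<open>{0..a $ i}\<close>.
\<close>

definition corner :: "real ^ 'n \<Rightarrow> real ^ 'n \<Rightarrow> bool" where
  "corner a w \<longleftrightarrow> (\<forall>i. w $ i \<in> {0, a $ i})"

definition hitting_time :: "real ^ 'n \<Rightarrow> real ^ 'n \<Rightarrow> real ^ 'n \<Rightarrow> real" where
  "hitting_time a x d = Inf {s. s > 0 \<and> (\<exists>i. (x + s *\<^sub>R d) $ i \<in> {0, a $ i})}"

definition reflect :: "real ^ 'n \<Rightarrow> real ^ 'n \<Rightarrow> real ^ 'n \<Rightarrow> real ^ 'n" where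
  "reflect a x d = (\<chi> i. if x $ i \<in> {0, a $ i} then - d $ i else d $ i)"

text \<open>
  A state \<open>(t, x, d)\<close> consists of the time and place of a bounce and the direction after it.
  The initial state is the start at the origin, where no reflection takes place.
\<close>

fun bounce ::
    "real ^ 'n \<Rightarrow> real \<times> (real ^ 'n) \<times> (real ^ 'n) \<Rightarrow> real \<times> (real ^ 'n) \<times> (real ^ 'n)" where
  "bounce a (t, x, d) =
    (let s = hitting_time a x d; y = x + s *\<^sub>R d in (t + s, y, reflect a y d))"

definition bounce_state :: "real ^ 'n \<Rightarrow> nat \<Rightarrow> real \<times> (real ^ 'n) \<times> (real ^ 'n)" where
  "bounce_state a k = (bounce a ^^ k) (0, 0, \<chi> i. 1)"

definition bounce_time :: "real ^ 'n \<Rightarrow> nat \<Rightarrow> real" where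
  "bounce_time a k = fst (bounce_state a k)"

text \<open>
  The billiard curve, continued for all times \<open>t \<ge> 0\<close> as if it did not stop at corners; the
  stopping rule is imposed by \<open>trajectory_domain\<close>. The number \<open>k\<close> selects a linear piece
  containing the time \<open>t\<close>.
\<close>

definition billiard_curve :: "real ^ 'n \<Rightarrow> real \<Rightarrow> real ^ 'n" where
  "billiard_curve a t =
    (let k = (LEAST k. t \<le> bounce_time a (Suc k)); (t\<^sub>k, x, d) = bounce_state a k
     in x + (t - t\<^sub>k) *\<^sub>R d)"

text \<open>
  The parameters up to and including the first time \<open>L\<close> at which the curve reaches a corner
  other than the origin, i.e. the interval \<open>{0..L}\<close> (or \<open>{0..}\<close> if there is no such time).
\<close>

definition trajectory_domain :: "real ^ 'n \<Rightarrow> real set" where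
  "trajectory_domain a =
    {t. t \<ge> 0 \<and>
        (\<forall>s. 0 \<le> s \<and> s < t \<longrightarrow> \<not> (corner a (billiard_curve a s) \<and> billiard_curve a s \<noteq> 0))}"

text \<open>Valued in \<^typ>\<open>enat\<close>, because \<^const>\<open>card\<close> would send an infinite set of parameters to 0.\<close>

definition crossing_number :: "real ^ 'n \<Rightarrow> real ^ 'n \<Rightarrow> enat" where
  "crossing_number a v =
    (let P = {t \<in> trajectory_domain a. billiard_curve a t = v}
     in if finite P then enat (card P) else \<infinity>)"

end

theory Submission
  imports Defs "HOL-Computational_Algebra.Primes"
begin

text \<open>
  Unfolding the reflections, the \<open>i\<close>-th coordinate of the trajectory at time \<open>t\<close> is the triangle
  wave of period \<open>2 a\<^sub>i\<close>, so \<open>t\<close> and \<open>t\<^sub>0\<close> reach the same point iff \<open>t \<equiv> \<plusminus>t\<^sub>0\<close> modulo \<open>2 a\<^sub>i\<close> for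
  each \<open>i\<close>, with independent signs. Write \<open>a\<^sub>i = g p\<^sub>i\<close> with integers \<open>p\<^sub>i\<close>; the motion stops at
  \<open>L = g P\<close>, where \<open>P\<close> is the least common multiple of the \<open>p\<^sub>i\<close>. If \<open>t\<^sub>0\<close> is not a multiple of
  \<open>g\<close>, all signs must agree and \<open>t\<^sub>0\<close> is the only solution in \<open>[0, L]\<close>. If \<open>t\<^sub>0 = g m\<close>, then by the
  generalised Chinese remainder theorem a choice of signs is realised iff \<open>gcd p\<^sub>i p\<^sub>j\<close> divides \<open>m\<close>
  whenever the signs at \<open>i\<close> and \<open>j\<close> differ. Hence the solutions modulo \<open>2 P\<close> correspond to a family
  of index sets that is closed under symmetric difference, and their number is a power of two.
  Away from the corners, \<open>t \<mapsto> 2 L - t\<close> pairs the solutions in \<open>[0, L]\<close> with the remaining ones.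
\<close>

section \<open>Families of sets closed under symmetric difference\<close>

text \<open>Such a family is a subspace of the vector space \<open>Pow A\<close> over the field with
  two elements. In the induction, either no member contains the new element \<open>a\<close>, or
  translation by a member \<open>Y\<close> containing \<open>a\<close> matches the members without
  \<open>a\<close> with those containing it, which doubles the count.\<close>

lemma card_power_of_2_if_sym_diff_closed:
  assumes "finite A" "F \<subseteq> Pow A" "{} \<in> F"
    and "\<And>X Y. X \<in> F \<Longrightarrow> Y \<in> F \<Longrightarrow> sym_diff X Y \<in> F"
  shows "\<exists>k. card F = 2 ^ k"
  using assms
proof (induction A arbitrary: F rule: finite_induct)
  case empty
  then have "F = {{}}" by auto
  then show ?case by (intro exI[of _ 0]) simp
next
  case (insert a A)
  define F0 where "F0 = {X \<in> F. a \<notin> X}"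
  have fin: "finite F"
    using insert.hyps(1) insert.prems(1) by (meson finite.insertI finite_Pow_iff finite_subset)
  have "\<exists>k. card F0 = 2 ^ k"
  proof (rule insert.IH)
    show "F0 \<subseteq> Pow A" using insert.prems(1) by (auto simp: F0_def)
    show "{} \<in> F0" using insert.prems(2) by (simp add: F0_def)
    show "sym_diff X Y \<in> F0" if "X \<in> F0" "Y \<in> F0" for X Y
      using that insert.prems(3)[of X Y] by (simp add: F0_def)
  qed
  then obtain k where k: "card F0 = 2 ^ k" ..
  show ?case
  proof (cases "F = F0")
    case True
    then show ?thesis using k by blast
  next
    case False
    then obtain Y where Y: "Y \<in> F" "a \<in> Y" by (auto simp: F0_def)
    have "bij_betw (sym_diff Y) F0 (F - F0)"
    proof (rule bij_betw_byWitness[where f' = "sym_diff Y"])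
      show "sym_diff Y ` F0 \<subseteq> F - F0" "sym_diff Y ` (F - F0) \<subseteq> F0"
        using Y insert.prems(3)[OF Y(1)] by (auto simp: F0_def)
    qed auto
    then have "card (F - F0) = card F0" by (simp add: bij_betw_same_card)
    moreover have "card F = card F0 + card (F - F0)"
      using fin by (metis (no_types, lifting) F0_def card_Diff_subset card_mono
          finite_subset le_add_diff_inverse mem_Collect_eq subsetI)
    ultimately show ?thesis using k by (intro exI[of _ "Suc k"]) simp
  qed
qed

section \<open>The Chinese remainder theorem for moduli that need not be coprime\<close>

text \<open>By distributivity, \<open>gcd (Lcm A) c\<close> is the lcm of the numbers
  \<open>gcd a c\<close>. This lets the congruences already solved act as a single one modulo their
  lcm.\<close>

lemma gcd_Lcm_dvd_int:
  fixes c z :: int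
  assumes "finite A" "\<And>a. a \<in> A \<Longrightarrow> gcd a c dvd z"
  shows "gcd (Lcm A) c dvd z"
  using assms by (induction A rule: finite_induct) (simp_all add: gcd_lcm_distrib gcd.commute[of _ c])

lemma chinese_remainder_gcd_int:
  fixes q r :: "'a \<Rightarrow> int"
  assumes "finite I"
    and "\<And>i j. i \<in> I \<Longrightarrow> j \<in> I \<Longrightarrow> gcd (q i) (q j) dvd r i - r j"
  shows "\<exists>x. \<forall>i\<in>I. q i dvd x - r i"
  using assms
proof (induction I rule: finite_induct)
  case empty
  then show ?case by simp
next
  case (insert k I)
  then obtain x where x: "\<And>i. i \<in> I \<Longrightarrow> q i dvd x - r i" by blast
  have "gcd (Lcm (q ` I)) (q k) dvd r k - x"
  proof (rule gcd_Lcm_dvd_int)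
    fix z assume "z \<in> q ` I"
    then obtain i where i: "i \<in> I" "z = q i" by blast
    have "gcd (q i) (q k) dvd r k - r i" "gcd (q i) (q k) dvd x - r i"
      using insert.prems[of k i] i x[OF i(1)] by (auto simp: gcd.commute intro: dvd_trans)
    from dvd_diff[OF this] show "gcd z (q k) dvd r k - x" using i by simp
  qed (use insert in simp)
  then obtain c where c: "r k - x = gcd (Lcm (q ` I)) (q k) * c" ..
  obtain u v where uv: "u * Lcm (q ` I) + v * q k = gcd (Lcm (q ` I)) (q k)"
    using bezout_int by blast
  \<comment> \<open>Adding a multiple of the lcm keeps the old congruences; Bezout's identity tells
    which multiple yields the residue \<open>r k\<close> modulo \<open>q k\<close>.\<close>
  define y where "y = x + c * u * Lcm (q ` I)"
  have "r k - x = u * Lcm (q ` I) * c + v * q k * c"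
    unfolding c uv[symmetric] by (simp add: algebra_simps)
  then have "y - r k = q k * (- v * c)"
    unfolding y_def by (simp add: algebra_simps)
  then have "q k dvd y - r k" by simp
  moreover have "q i dvd y - r i" if "i \<in> I" for i
  proof -
    have "q i dvd c * u * Lcm (q ` I)" using that by (simp add: dvd_Lcm dvd_mult)
    from dvd_add[OF x[OF that] this] show ?thesis by (simp add: y_def algebra_simps)
  qed
  ultimately show ?case by blast
qed


section \<open>Counting the solutions of x \<equiv> +-m modulo all 2 p_i\<close>

lemma two_times_Lcm_dvd_iff:
  fixes p :: "'a \<Rightarrow> int"
  shows "2 * Lcm (range p) dvd z \<longleftrightarrow> (\<forall>i. 2 * p i dvd z)"
proof
  assume "\<forall>i. 2 * p i dvd z"
  moreover from this have "even z" by (meson dvd_mult_left)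
  then obtain c where "z = 2 * c" ..
  ultimately show "2 * Lcm (range p) dvd z" by (auto intro: Lcm_least)
next
  assume z: "2 * Lcm (range p) dvd z"
  have "2 * p i dvd 2 * Lcm (range p)" for i by (simp add: dvd_Lcm)
  then show "\<forall>i. 2 * p i dvd z" using z by (meson dvd_trans)
qed

lemma Lcm_range_pos:
  fixes p :: "'a::finite \<Rightarrow> int"
  assumes "\<And>i. p i > 0"
  shows "Lcm (range p) > 0"
proof -
  have "0 \<notin> range p" using assms by (metis imageE less_irrefl)
  then have "Lcm (range p) \<noteq> 0" by (simp add: Lcm_0_iff)
  moreover have "Lcm (range p) \<ge> 0" by simp
  ultimately show ?thesis by linarith
qed

text \<open>Otherwise 2 P would divide P > 0. This tells the end corner, at integer time P, from the
  starting corner.\<close>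

lemma not_twice_dvd_Lcm:
  fixes p :: "'a::finite \<Rightarrow> int"
  assumes "\<And>i. p i > 0"
  shows "\<not> (\<forall>i. 2 * p i dvd Lcm (range p))"
  using zdvd_imp_le[of "2 * Lcm (range p)" "Lcm (range p)"] Lcm_range_pos[of p] assms
  unfolding two_times_Lcm_dvd_iff[symmetric] by fastforce

text \<open>A solution is determined modulo 2 P by its signs, so it suffices to count the realisable
  sign patterns.\<close>

lemma card_solutions_mod_power_of_2:
  fixes p :: "'a::finite \<Rightarrow> int"
  assumes pos: "\<And>i. p i > 0"
  shows "\<exists>k. card {x \<in> {0..<2 * Lcm (range p)}. \<forall>i. 2 * p i dvd x - m \<or> 2 * p i dvd x + m} = 2 ^ k"
proof -
  define P where "P = Lcm (range p)"
  define S where "S = {x \<in> {0..<2 * P}. \<forall>i. 2 * p i dvd x - m \<or> 2 * p i dvd x + m}"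
  \<comment> \<open>The index sets that can carry the minus sign. If \<open>p i\<close> divides
    \<open>m\<close>, then m and -m agree modulo \<open>2 * p i\<close>; such an index counts as
    plus, so that each pattern has only one encoding.\<close>
  define F where "F = {X. (\<forall>i\<in>X. \<not> p i dvd m) \<and> (\<forall>i\<in>X. \<forall>j. j \<notin> X \<longrightarrow> gcd (p i) (p j) dvd m)}"
  define \<phi> where "\<phi> x = {i. \<not> p i dvd m \<and> \<not> 2 * p i dvd x - m}" for x
  have P: "P > 0" using Lcm_range_pos[OF pos] by (simp add: P_def)
  have "bij_betw \<phi> S F"
  proof (rule bij_betw_imageI)
    have "x = y" if xy: "x \<in> S" "y \<in> S" "\<phi> x = \<phi> y" for x y
    proof -
      have "2 * p i dvd x - y" for i
      \<comment> \<open>In the first case x \<equiv> -m holds for both solutions: if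
        \<open>p i\<close> divides \<open>m\<close>, the sign may be changed freely because 2 m
        vanishes modulo \<open>2 * p i\<close>.\<close>
      proof (cases "p i dvd m \<or> i \<in> \<phi> x")
        case True
        have m: "2 * p i dvd 2 * m" if "p i dvd m" using that by simp
        have "2 * p i dvd x + m"
          using xy(1) True dvd_add[of "2 * p i" "x - m" "2 * m"] m
          by (auto simp: S_def \<phi>_def add.commute)
        moreover have "2 * p i dvd y + m"
          using xy(2) True dvd_add[of "2 * p i" "y - m" "2 * m"] m unfolding xy(3)
          by (auto simp: S_def \<phi>_def add.commute)
        ultimately show ?thesis using dvd_diff[of "2 * p i" "x + m" "y + m"] by simp
      next
        case False
        then have "2 * p i dvd x - m" "2 * p i dvd y - m"
          using xy(3) by (auto simp: \<phi>_def)
        then show ?thesis using dvd_diff[of "2 * p i" "x - m" "y - m"] by simp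
      qed
      then have "2 * P dvd x - y" by (simp add: P_def two_times_Lcm_dvd_iff)
      then have "x mod (2 * P) = y mod (2 * P)" by (simp add: mod_eq_dvd_iff)
      then show "x = y" using xy by (simp add: S_def)
    qed
    then show "inj_on \<phi> S" by (auto intro: inj_onI)
    have "\<phi> x \<in> F" if x: "x \<in> S" for x
    proof -
      have "gcd (p i) (p j) dvd m" if ij: "i \<in> \<phi> x" "j \<notin> \<phi> x" for i j
      proof (cases "p j dvd m")
        case True
        then show ?thesis by (meson dvd_trans gcd_dvd2)
      next
        case False
        then have "2 * p j dvd x - m" "2 * p i dvd x + m"
          using ij x by (auto simp: \<phi>_def S_def)
        moreover have "2 * gcd (p i) (p j) dvd 2 * p j" "2 * gcd (p i) (p j) dvd 2 * p i" by simp_all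
        ultimately have "2 * gcd (p i) (p j) dvd (x + m) - (x - m)"
          by (meson dvd_diff dvd_trans)
        then show ?thesis by simp
      qed
      then show ?thesis by (auto simp: F_def \<phi>_def)
    qed
    moreover have "X \<in> \<phi> ` S" if X: "X \<in> F" for X
    proof -
      \<comment> \<open>Prescribed residues for the pattern \<open>X\<close>. Their differences are
        0 or +-2 m, and 2 m only occurs between indices separated by \<open>X\<close>, where
        \<open>F\<close> supplies the gcd condition.\<close>
      define r where "r i = (if i \<in> X then - m else m)" for i
      have g: "gcd (p i) (p j) dvd m" if "i \<in> X \<longleftrightarrow> j \<notin> X" for i j
        using X that by (cases "i \<in> X") (auto simp: F_def gcd.commute)
      have "gcd (2 * p i) (2 * p j) dvd r i - r j" for i j
      proof -
        have "gcd (2 * p i) (2 * p j) = 2 * gcd (p i) (p j)"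
          using gcd_mult_distrib_int[of 2 "p i" "p j"] by simp
        moreover have "r i - r j = 0 \<or> (i \<in> X \<longleftrightarrow> j \<notin> X) \<and> (r i - r j = 2 * m \<or> r i - r j = 2 * (- m))"
          by (auto simp: r_def)
        ultimately show ?thesis using g[of i j] by (auto simp del: mult_minus_right)
      qed
      then obtain z where z: "\<And>i. 2 * p i dvd z - r i"
        using chinese_remainder_gcd_int[of UNIV "\<lambda>i. 2 * p i" r] by auto
      define x where "x = z mod (2 * P)"
      have x: "2 * p i dvd x - r i" for i
      proof -
        have "2 * P dvd x - z" unfolding x_def by (simp add: mod_eq_dvd_iff[symmetric])
        then have "2 * p i dvd x - z" by (simp add: P_def two_times_Lcm_dvd_iff)
        from dvd_add[OF this z[of i]] show ?thesis by simp
      qed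
      have "x \<in> S"
        using P x unfolding S_def x_def r_def by (auto split: if_splits) (metis diff_minus_eq_add)
      moreover have "i \<in> \<phi> x \<longleftrightarrow> i \<in> X" for i
      proof (cases "i \<in> X")
        case True
        then have "2 * p i dvd x + m" using x[of i] by (simp add: r_def)
        then have "2 * p i dvd x - m \<Longrightarrow> 2 * p i dvd 2 * m"
          using dvd_diff[of "2 * p i" "x + m" "x - m"] by simp
        then show ?thesis using True X by (auto simp: \<phi>_def F_def)
      next
        case False
        then show ?thesis using x[of i] by (simp add: \<phi>_def r_def)
      qed
      ultimately show ?thesis by blast
    qed
    ultimately show "\<phi> ` S = F" by blast
  qed
  then have "card S = card F" by (rule bij_betw_same_card)
  moreover have "\<exists>k. card F = 2 ^ k"
  proof (rule card_power_of_2_if_sym_diff_closed[of UNIV])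
    show "sym_diff X Y \<in> F" if "X \<in> F" "Y \<in> F" for X Y
    proof -
      have sep: "gcd (p i) (p j) dvd m" if "Z \<in> F" "i \<in> Z \<longleftrightarrow> j \<notin> Z" for Z i j
        using that by (cases "i \<in> Z") (auto simp: F_def gcd.commute)
      \<comment> \<open>Exactly one of \<open>X\<close> and \<open>Y\<close> separates
        \<open>i\<close> from \<open>j\<close>, and its membership in \<open>F\<close> gives the
        divisibility.\<close>
      have "gcd (p i) (p j) dvd m" if "i \<in> sym_diff X Y" "j \<notin> sym_diff X Y" for i j
        using that sep[OF \<open>X \<in> F\<close>, of i j] sep[OF \<open>Y \<in> F\<close>, of i j] by blast
      then show ?thesis using that by (auto simp: F_def)
    qed
  qed (auto simp: F_def)
  ultimately show ?thesis by (simp add: S_def P_def)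
qed

text \<open>The reflection x -> 2 P - x preserves solutions and swaps the two halves of a period,
  apart from the multiples of P. These are solutions only if P divides \<open>m\<close>, and then
  \<open>m\<close> is the only solution in [0, P].\<close>

lemma card_half_solutions_power_of_2:
  fixes p :: "'a::finite \<Rightarrow> int"
  assumes pos: "\<And>i. p i > 0" and m: "m \<in> {0..Lcm (range p)}"
  shows "\<exists>k. card {x \<in> {0..Lcm (range p)}. \<forall>i. 2 * p i dvd x - m \<or> 2 * p i dvd x + m} = 2 ^ k"
proof -
  define P where "P = Lcm (range p)"
  define sol where "sol x \<longleftrightarrow> (\<forall>i. 2 * p i dvd x - m \<or> 2 * p i dvd x + m)" for x
  define T where "T = {x \<in> {0..P}. sol x}"
  have P: "P > 0" using Lcm_range_pos[OF pos] by (simp add: P_def)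
  have pP: "p i dvd P" for i by (simp add: P_def dvd_Lcm)
  have sol_m: "sol m" by (simp add: sol_def)
  have end_iff: "P dvd x \<longleftrightarrow> x = 0 \<or> x = P" if "x \<in> {0..P}" for x
    using that zdvd_imp_le[of P x] by force
  have "\<exists>k. card T = 2 ^ k"
  proof (cases "P dvd m")
    case True
    have "x = m" if x: "x \<in> T" for x
    proof -
      have "p i dvd x" for i
      proof -
        have "p i dvd x - m \<or> p i dvd x + m" using x unfolding T_def sol_def by (auto dest: dvd_mult_right)
        moreover have "p i dvd m" using pP True dvd_trans by blast
        ultimately show ?thesis by (metis dvd_add_left_iff dvd_diff_right_iff dvd_diff_left_iff)
      qed
      then have "P dvd x" by (auto simp: P_def intro: Lcm_least)
      then have "x = 0 \<or> x = P" "m = 0 \<or> m = P"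
        using end_iff x m True by (auto simp: T_def P_def)
      then show ?thesis
        using x not_twice_dvd_Lcm[of p] pos by (auto simp: T_def sol_def P_def)
    qed
    then have "T = {m}" using m sol_m by (auto simp: T_def P_def)
    then show ?thesis by (intro exI[of _ 0]) simp
  next
    case False
    have not_sol: "\<not> sol x" if "P dvd x" for x
    proof
      assume "sol x"
      have "p i dvd m" for i
      proof -
        have "p i dvd x - m \<or> p i dvd x + m" using \<open>sol x\<close> unfolding sol_def by (auto dest: dvd_mult_right)
        moreover have "p i dvd x" using pP that dvd_trans by blast
        ultimately show ?thesis by (metis dvd_add_right_iff dvd_diff_right_iff)
      qed
      then show False using False by (auto simp: P_def intro: Lcm_least)
    qed
    have refl: "sol (2 * P - x)" if "sol x" for x
      unfolding sol_def
    proof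
      fix i
      have i: "2 * p i dvd 2 * P" using pP by simp
      show "2 * p i dvd 2 * P - x - m \<or> 2 * p i dvd 2 * P - x + m"
        using that[unfolded sol_def, rule_format, of i] dvd_diff[OF i, of "x - m"] dvd_diff[OF i, of "x + m"]
        by (auto simp: algebra_simps)
    qed
    define T' where "T' = {x \<in> {P<..<2*P}. sol x}"
    have split: "{x \<in> {0..<2 * P}. sol x} = T \<union> T'"
      using P by (auto simp: T_def T'_def)
    have "bij_betw (\<lambda>x. 2 * P - x) T T'"
    proof (rule bij_betw_byWitness[where f' = "\<lambda>x. 2 * P - x"])
      show "(\<lambda>x. 2 * P - x) ` T \<subseteq> T'"
      proof clarify
        fix x assume x: "x \<in> T"
        then have "x \<noteq> 0" "x \<noteq> P" using not_sol by (auto simp: T_def)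
        then show "2 * P - x \<in> T'" using x refl by (auto simp: T_def T'_def)
      qed
      show "(\<lambda>x. 2 * P - x) ` T' \<subseteq> T" using refl by (auto simp: T_def T'_def)
    qed auto
    then have "card T' = card T" by (simp add: bij_betw_same_card)
    moreover have "finite T" "finite T'" "T \<inter> T' = {}"
      by (auto simp: T_def T'_def intro: finite_subset[of _ "{0..2 * P}"])
    ultimately have "card {x \<in> {0..<2 * P}. sol x} = 2 * card T"
      unfolding split by (simp add: card_Un_disjoint)
    moreover obtain k where "card {x \<in> {0..<2 * P}. sol x} = 2 ^ k"
      using card_solutions_mod_power_of_2[of p m] pos unfolding P_def sol_def by blast
    ultimately have k: "2 * card T = 2 ^ k" by simp
    \<comment> \<open>The left side is even, so \<open>k\<close> is not 0 and one factor 2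
      cancels.\<close>
    then show ?thesis by (cases k) auto
  qed
  then show ?thesis by (simp add: T_def sol_def P_def)
qed

section \<open>The triangle wave\<close>

text \<open>For \<open>b > 0\<close>, the distance from \<open>t\<close> to the nearest even
  multiple of \<open>b\<close>.\<close>

definition zigzag :: "real \<Rightarrow> real \<Rightarrow> real" where
  "zigzag b t = (if even \<lfloor>t / b\<rfloor> then t - of_int \<lfloor>t / b\<rfloor> * b else of_int (\<lfloor>t / b\<rfloor> + 1) * b - t)"

text \<open>The right derivative of the wave; at a multiple of \<open>b\<close> it is thus the
  velocity after the reflection.\<close>

definition zigzag_slope :: "real \<Rightarrow> real \<Rightarrow> real" where
  "zigzag_slope b t = (if even \<lfloor>t / b\<rfloor> then 1 else -1)"

text \<open>The right endpoint is allowed although the floor has already jumped there: by continuity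
  the formulas of the two adjacent pieces agree.\<close>

lemma zigzag_eqI:
  assumes "b > 0" "of_int k * b \<le> t" "t \<le> of_int (k + 1) * b"
  shows "zigzag b t = (if even k then t - of_int k * b else of_int (k + 1) * b - t)"
proof (cases "t = of_int (k + 1) * b")
  case True
  then have "\<lfloor>t / b\<rfloor> = k + 1" using assms by simp
  then show ?thesis using True by (simp add: zigzag_def algebra_simps)
next
  case False
  have "\<lfloor>t / b\<rfloor> = k"
    using assms False by (intro floor_unique) (auto simp: field_simps)
  then show ?thesis by (simp add: zigzag_def)
qed

lemma floor_bounds:
  fixes b t :: real
  assumes "b > 0"
  shows "of_int \<lfloor>t / b\<rfloor> * b \<le> t" "t < of_int (\<lfloor>t / b\<rfloor> + 1) * b"
  using floor_correct[of "t / b"]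
  by (simp_all only: pos_le_divide_eq[OF assms] pos_divide_less_eq[OF assms])

lemma zigzag_range:
  assumes "b > 0" shows "0 \<le> zigzag b t" "zigzag b t \<le> b"
  using floor_bounds[OF assms, of t] by (auto simp: zigzag_def algebra_simps)

lemma zigzag_eq_plus_slope:
  assumes "b > 0" "0 \<le> s" "t + s \<le> of_int (\<lfloor>t / b\<rfloor> + 1) * b"
  shows "zigzag b (t + s) = zigzag b t + s * zigzag_slope b t"
  using zigzag_eqI[of b "\<lfloor>t / b\<rfloor>" "t + s"] floor_bounds[of b t] assms
  by (auto simp: zigzag_def zigzag_slope_def)

lemma zigzag_at_end_iff:
  assumes "b > 0"
  shows "zigzag b t \<in> {0, b} \<longleftrightarrow> (\<exists>k::int. t = of_int k * b)"
proof
  assume "zigzag b t \<in> {0, b}"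
  then show "\<exists>k::int. t = of_int k * b"
  proof
    assume "zigzag b t = 0"
    then show ?thesis by (auto simp: zigzag_def split: if_splits) (metis of_int_1 of_int_add)
  next
    assume "zigzag b t \<in> {b}"
    then have "t = of_int (\<lfloor>t / b\<rfloor> + 1) * b \<or> t = of_int \<lfloor>t / b\<rfloor> * b"
      by (auto simp: zigzag_def algebra_simps split: if_splits)
    then show ?thesis by blast
  qed
next
  assume "\<exists>k::int. t = of_int k * b"
  then obtain k :: int where k: "t = of_int k * b" ..
  then show "zigzag b t \<in> {0, b}" using assms zigzag_eqI[of b k t] by (auto simp: algebra_simps)
qed

lemma zigzag_eq_0_iff:
  assumes "b > 0"
  shows "zigzag b t = 0 \<longleftrightarrow> (\<exists>k::int. t = of_int k * (2 * b))"
proof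
  assume z: "zigzag b t = 0"
  show "\<exists>k::int. t = of_int k * (2 * b)"
  proof (cases "even \<lfloor>t / b\<rfloor>")
    case True
    then obtain k where "\<lfloor>t / b\<rfloor> = 2 * k" ..
    then show ?thesis using z by (intro exI[of _ k]) (simp add: zigzag_def)
  next
    case False
    then show ?thesis using z floor_bounds[OF assms, of t] by (simp add: zigzag_def)
  qed
next
  assume "\<exists>k::int. t = of_int k * (2 * b)"
  then obtain k :: int where k: "t = of_int k * (2 * b)" ..
  then show "zigzag b t = 0" using assms zigzag_eqI[of b "2 * k" t] by simp
qed

lemma zigzag_congruent:
  "\<exists>k::int. zigzag b t = t + of_int k * (2 * b) \<or> zigzag b t = - t + of_int k * (2 * b)"
proof (cases "even \<lfloor>t / b\<rfloor>")
  case True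
  then obtain k where "\<lfloor>t / b\<rfloor> = 2 * k" ..
  then show ?thesis by (intro exI[of _ "- k"]) (simp add: zigzag_def)
next
  case False
  then obtain k where "\<lfloor>t / b\<rfloor> = 2 * k + 1" by (rule oddE)
  then show ?thesis by (intro exI[of _ "k + 1"]) (simp add: zigzag_def algebra_simps)
qed

text \<open>Replacing \<open>t\<close> and \<open>u\<close> by their wave values changes them only
  by sign and multiples of 2 b, which at most swaps the two alternatives. For values in [0, b],
  either alternative forces equality.\<close>

lemma zigzag_eq_iff:
  assumes b: "b > 0"
  shows "zigzag b t = zigzag b u \<longleftrightarrow> (\<exists>k::int. t - u = of_int k * (2 * b) \<or> t + u = of_int k * (2 * b))"
    (is "_ \<longleftrightarrow> ?R")
proof -
  obtain i :: int where i: "zigzag b t = t + of_int i * (2 * b) \<or> zigzag b t = - t + of_int i * (2 * b)"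
    using zigzag_congruent by blast
  obtain j :: int where j: "zigzag b u = u + of_int j * (2 * b) \<or> zigzag b u = - u + of_int j * (2 * b)"
    using zigzag_congruent by blast
  define cong where "cong x \<longleftrightarrow> (\<exists>k::int. x = of_int k * (2 * b))" for x
  have cong_add: "cong (x + of_int k * (2 * b)) \<longleftrightarrow> cong x" for x k
  proof
    assume "cong (x + of_int k * (2 * b))"
    then obtain l :: int where "x + of_int k * (2 * b) = of_int l * (2 * b)" unfolding cong_def ..
    then have "x = of_int (l - k) * (2 * b)" by (simp add: algebra_simps)
    then show "cong x" unfolding cong_def ..
  next
    assume "cong x"
    then obtain l :: int where "x = of_int l * (2 * b)" unfolding cong_def ..
    then have "x + of_int k * (2 * b) = of_int (l + k) * (2 * b)" by (simp add: algebra_simps)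
    then show "cong (x + of_int k * (2 * b))" unfolding cong_def ..
  qed
  have cong_minus: "cong (- x) \<longleftrightarrow> cong x" for x
  proof -
    have "cong (- y)" if c: "cong y" for y
    proof -
      obtain l :: int where "y = of_int l * (2 * b)" using c unfolding cong_def ..
      then have "- y = of_int (- l) * (2 * b)" by simp
      then show ?thesis unfolding cong_def ..
    qed
    from this[of x] this[of "- x"] show ?thesis by auto
  qed
  have "?R \<longleftrightarrow> cong (t - u) \<or> cong (t + u)" by (auto simp: cong_def)
  also have "\<dots> \<longleftrightarrow> cong (zigzag b t - zigzag b u) \<or> cong (zigzag b t + zigzag b u)"
    using i
  proof
    assume t: "zigzag b t = t + of_int i * (2 * b)"
    from j show ?thesis
    proof
      assume u: "zigzag b u = u + of_int j * (2 * b)"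
      show ?thesis unfolding t u
        using cong_add[of "t - u" "i - j"] cong_add[of "t + u" "i + j"] by (simp add: algebra_simps)
    next
      assume u: "zigzag b u = - u + of_int j * (2 * b)"
      show ?thesis unfolding t u
        using cong_add[of "t + u" "i - j"] cong_add[of "t - u" "i + j"] by (auto simp: algebra_simps)
    qed
  next
    assume t: "zigzag b t = - t + of_int i * (2 * b)"
    from j show ?thesis
    proof
      assume u: "zigzag b u = u + of_int j * (2 * b)"
      show ?thesis unfolding t u
        using cong_add[of "- (t + u)" "i - j"] cong_add[of "- (t - u)" "i + j"]
          cong_minus[of "t - u"] cong_minus[of "t + u"] by (auto simp: algebra_simps)
    next
      assume u: "zigzag b u = - u + of_int j * (2 * b)"
      show ?thesis unfolding t u
        using cong_add[of "- (t - u)" "i - j"] cong_add[of "- (t + u)" "i + j"]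
          cong_minus[of "t - u"] cong_minus[of "t + u"] by (simp add: algebra_simps)
    qed
  qed
  also have "\<dots> \<longleftrightarrow> zigzag b t = zigzag b u"
  proof
    assume "cong (zigzag b t - zigzag b u) \<or> cong (zigzag b t + zigzag b u)"
    then show "zigzag b t = zigzag b u"
    proof
      assume "cong (zigzag b t - zigzag b u)"
      then obtain k :: int where k: "zigzag b t - zigzag b u = of_int k * (2 * b)" unfolding cong_def ..
      have "\<bar>of_int k * (2 * b)\<bar> \<le> b"
        using zigzag_range[OF b, of t] zigzag_range[OF b, of u] k by linarith
      then have "\<bar>of_int k\<bar> * 2 \<le> (1::real)" using b by (simp add: abs_mult)
      then have "k = 0" by linarith
      then show ?thesis using k by simp
    next
      assume "cong (zigzag b t + zigzag b u)"
      then obtain k :: int where k: "zigzag b t + zigzag b u = of_int k * (2 * b)" unfolding cong_def ..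
      have "0 \<le> of_int k * (2 * b)" "of_int k * (2 * b) \<le> 1 * (2 * b)"
        using zigzag_range[OF b, of t] zigzag_range[OF b, of u] k by linarith+
      then have "0 \<le> k" "k \<le> 1" using b by (simp_all add: zero_le_mult_iff del: mult_1)
      \<comment> \<open>A sum of 0 makes both values 0, a sum of 2 b makes both equal to
        \<open>b\<close>.\<close>
      then have "k = 0 \<or> k = 1" by linarith
      then show ?thesis
        using zigzag_range[OF b, of t] zigzag_range[OF b, of u] k by auto
    qed
  next
    assume "zigzag b t = zigzag b u"
    then show "cong (zigzag b t - zigzag b u) \<or> cong (zigzag b t + zigzag b u)"
      by (auto simp: cong_def intro: exI[of _ 0])
  qed
  finally show ?thesis ..
qed

section \<open>The billiard curve as a vector of triangle waves\<close>

definition zigzag_vec :: "real ^ 'n \<Rightarrow> real \<Rightarrow> real ^ 'n" where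
  "zigzag_vec a t = (\<chi> i. zigzag (a $ i) t)"

definition zigzag_slope_vec :: "real ^ 'n \<Rightarrow> real \<Rightarrow> real ^ 'n" where
  "zigzag_slope_vec a t = (\<chi> i. zigzag_slope (a $ i) t)"

text \<open>The summand 1 keeps this strictly later than \<open>t\<close>, even when
  \<open>t\<close> is itself a bounce time.\<close>

definition next_bounce :: "real ^ 'n \<Rightarrow> real \<Rightarrow> real" where
  "next_bounce a t = Min (range (\<lambda>i. of_int (\<lfloor>t / a $ i\<rfloor> + 1) * a $ i))"

lemma next_bounce_le: "next_bounce a t \<le> of_int (\<lfloor>t / a $ i\<rfloor> + 1) * a $ i"
  unfolding next_bounce_def by (rule Min_le) auto

lemma next_bounce_attained: "\<exists>i. next_bounce a t = of_int (\<lfloor>t / a $ i\<rfloor> + 1) * a $ i"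
proof -
  have "next_bounce a t \<in> range (\<lambda>i. of_int (\<lfloor>t / a $ i\<rfloor> + 1) * a $ i)"
    unfolding next_bounce_def by (rule Min_in) auto
  then show ?thesis by blast
qed

lemma next_bounce_gt:
  assumes "\<forall>i. a $ i > 0" shows "t < next_bounce a t"
  using next_bounce_attained[of a t] floor_bounds(2)[of _ t] assms by metis

lemma zigzag_vec_eq_plus_slope:
  assumes "\<forall>i. a $ i > 0" "t \<le> u" "u \<le> next_bounce a t"
  shows "zigzag_vec a u = zigzag_vec a t + (u - t) *\<^sub>R zigzag_slope_vec a t"
proof (rule vec_eq_iff[THEN iffD2], rule)
  fix i
  show "zigzag_vec a u $ i = (zigzag_vec a t + (u - t) *\<^sub>R zigzag_slope_vec a t) $ i"
    using zigzag_eq_plus_slope[of "a $ i" "u - t" t] assms next_bounce_le[of a t i]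
    by (simp add: zigzag_vec_def zigzag_slope_vec_def)
qed

lemma hitting_time_zigzag:
  assumes a: "\<forall>i. a $ i > 0"
  shows "hitting_time a (zigzag_vec a t) (zigzag_slope_vec a t) = next_bounce a t - t"
proof -
  let ?f = "zigzag_vec a t" and ?d = "zigzag_slope_vec a t"
  let ?H = "{s. s > 0 \<and> (\<exists>i. (?f + s *\<^sub>R ?d) $ i \<in> {0, a $ i})}"
  define e where "e i = of_int (\<lfloor>t / a $ i\<rfloor> + 1) * a $ i" for i
  have e: "t < e i" for i using floor_bounds(2)[of "a $ i" t] a by (simp add: e_def)
  \<comment> \<open>A coordinate moving along the straight ray has one end of its interval ahead and
    the other behind or at its present place, so it has just one positive hitting time.\<close>
  have hit: "(?f + s *\<^sub>R ?d) $ i \<in> {0, a $ i} \<longleftrightarrow> t + s = e i" if "s > 0" for s i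
    using floor_bounds(1)[of "a $ i" t] a that
    by (auto simp: e_def zigzag_vec_def zigzag_slope_vec_def zigzag_def zigzag_slope_def algebra_simps)
  have "?H = range (\<lambda>i. e i - t)"
  proof (intro set_eqI iffI)
    fix s assume "s \<in> range (\<lambda>i. e i - t)"
    then obtain i where i: "s = e i - t" by blast
    then have "s > 0" using e[of i] by simp
    moreover have "t + s = e i" using i by simp
    ultimately show "s \<in> ?H" using hit by blast
  next
    fix s assume "s \<in> ?H"
    then obtain i where "t + s = e i" using hit by blast
    then have "s = e i - t" by simp
    then show "s \<in> range (\<lambda>i. e i - t)" by blast
  qed
  then have "hitting_time a ?f ?d = Min (range (\<lambda>i. e i - t))"
    unfolding hitting_time_def by (simp add: cInf_eq_Min)
  also have "\<dots> = next_bounce a t - t"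
  proof (rule Min_eqI)
    show "next_bounce a t - t \<le> y" if "y \<in> range (\<lambda>i. e i - t)" for y
      using that next_bounce_le[of a t] by (auto simp: e_def)
    show "next_bounce a t - t \<in> range (\<lambda>i. e i - t)"
      using next_bounce_attained[of a t] by (auto simp: e_def)
  qed simp
  finally show ?thesis .
qed

text \<open>The floor of u / a_i steps up, reversing the slope, exactly for the coordinates on the
  boundary at time u. As this is decided coordinatewise, simultaneous hits need no special
  care.\<close>

lemma reflect_zigzag:
  assumes a: "\<forall>i. a $ i > 0"
  shows "reflect a (zigzag_vec a (next_bounce a t)) (zigzag_slope_vec a t) = zigzag_slope_vec a (next_bounce a t)"
proof (rule vec_eq_iff[THEN iffD2], rule)
  fix i
  let ?b = "a $ i" and ?u = "next_bounce a t"
  have b: "?b > 0" using a by simp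
  define k where "k = \<lfloor>t / ?b\<rfloor>"
  have k: "of_int k * ?b \<le> t" using floor_bounds(1)[OF b] by (simp add: k_def)
  have u: "t < ?u" "?u \<le> of_int (k + 1) * ?b"
    using next_bounce_gt[OF a] next_bounce_le[of a t i] by (simp_all add: k_def)
  have "zigzag ?b ?u \<in> {0, ?b} \<longleftrightarrow> ?u = of_int (k + 1) * ?b"
    using zigzag_eqI[of ?b k ?u] b k u by (auto simp: algebra_simps)
  moreover have "\<lfloor>?u / ?b\<rfloor> = k + 1" if "?u = of_int (k + 1) * ?b" using that b by simp
  moreover have "\<lfloor>?u / ?b\<rfloor> = k" if "?u \<noteq> of_int (k + 1) * ?b"
    using that b k u by (intro floor_unique) (auto simp: field_simps)
  ultimately show "reflect a (zigzag_vec a ?u) (zigzag_slope_vec a t) $ i = zigzag_slope_vec a ?u $ i"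
    by (auto simp: reflect_def zigzag_vec_def zigzag_slope_vec_def zigzag_slope_def simp flip: k_def)
qed

lemma bounce_zigzag:
  assumes "\<forall>i. a $ i > 0"
  shows "bounce a (t, zigzag_vec a t, zigzag_slope_vec a t) =
    (next_bounce a t, zigzag_vec a (next_bounce a t), zigzag_slope_vec a (next_bounce a t))"
proof -
  have "zigzag_vec a t + (next_bounce a t - t) *\<^sub>R zigzag_slope_vec a t = zigzag_vec a (next_bounce a t)"
    using zigzag_vec_eq_plus_slope[OF assms, of t "next_bounce a t"] next_bounce_gt[OF assms, of t]
    by simp
  then show ?thesis by (simp add: hitting_time_zigzag[OF assms] reflect_zigzag[OF assms] Let_def)
qed

lemma bounce_state_eq:
  assumes "\<forall>i. a $ i > 0"
  shows "bounce_state a k =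
    (bounce_time a k, zigzag_vec a (bounce_time a k), zigzag_slope_vec a (bounce_time a k))"
proof (induction k)
  case 0
  show ?case
    by (simp add: bounce_state_def bounce_time_def vec_eq_iff zigzag_vec_def zigzag_slope_vec_def zigzag_def zigzag_slope_def)
next
  case (Suc k)
  have "bounce_state a (Suc k) = bounce a (bounce_state a k)"
    by (simp add: bounce_state_def)
  then show ?case
    unfolding Suc bounce_zigzag[OF assms] by (simp add: bounce_time_def)
qed

lemma bounce_time_0: "bounce_time a 0 = 0"
  by (simp add: bounce_time_def bounce_state_def)

lemma bounce_time_Suc:
  assumes "\<forall>i. a $ i > 0"
  shows "bounce_time a (Suc k) = next_bounce a (bounce_time a k)"
proof -
  have "bounce_time a (Suc k) = fst (bounce a (bounce_state a k))"
    by (simp add: bounce_state_def bounce_time_def)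
  also have "\<dots> = next_bounce a (bounce_time a k)"
    unfolding bounce_state_eq[OF assms, of k] bounce_zigzag[OF assms] by simp
  finally show ?thesis .
qed

text \<open>Bounce times are strictly increasing multiples of the unit \<open>g\<close>, hence
  unbounded. So the \<open>LEAST\<close> in the curve's definition exists and picks a linear piece
  whose time interval contains \<open>t\<close>.\<close>

lemma billiard_curve_eq_zigzag:
  fixes a :: "real ^ 'n" and p :: "'n \<Rightarrow> int"
  assumes g: "g > 0" and p: "\<And>i. p i > 0" and a: "\<And>i. a $ i = g * of_int (p i)"
    and t: "t \<ge> 0"
  shows "billiard_curve a t = zigzag_vec a t"
proof -
  have pos: "\<forall>i. a $ i > 0" using g p a by simp
  let ?T = "bounce_time a"
  have unit: "\<exists>m::int. ?T k = g * of_int m" for k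
  proof (cases k)
    case 0
    then show ?thesis by (intro exI[of _ 0]) (simp add: bounce_time_0)
  next
    case (Suc j)
    obtain i where "?T k = of_int (\<lfloor>?T j / a $ i\<rfloor> + 1) * a $ i"
      using Suc next_bounce_attained bounce_time_Suc[OF pos] by metis
    then have "?T k = g * of_int ((\<lfloor>?T j / a $ i\<rfloor> + 1) * p i)" by (simp add: a)
    then show ?thesis by blast
  qed
  have ge: "?T k \<ge> of_nat k * g" for k
  proof (induction k)
    case (Suc k)
    obtain m l :: int where ml: "?T k = g * of_int m" "?T (Suc k) = g * of_int l"
      using unit by meson
    have "?T k < ?T (Suc k)" using next_bounce_gt[OF pos] bounce_time_Suc[OF pos] by metis
    then have "m < l" using ml g by simp
    then have "g * of_int m + g \<le> g * of_int l"
      using g by (metis distrib_left le_less mult.right_neutral mult_le_cancel_left_pos of_int_1 of_int_add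
        of_int_le_iff zless_imp_add1_zle)
    then show ?case using Suc ml by (simp add: algebra_simps)
  qed (simp add: bounce_time_0)
  obtain n :: nat where "t < of_nat n * g" using reals_Archimedean3[OF g] by blast
  then have ex: "t \<le> ?T (Suc n)" using ge[of "Suc n"] g by (simp add: algebra_simps)
  define k where "k = (LEAST k. t \<le> ?T (Suc k))"
  have le: "t \<le> ?T (Suc k)" unfolding k_def by (rule LeastI[of _ n]) (rule ex)
  have "?T k \<le> t"
  proof (cases k)
    case 0
    then show ?thesis using t by (simp add: bounce_time_0)
  next
    case (Suc j)
    then have "\<not> t \<le> ?T (Suc j)" using not_less_Least[of j "\<lambda>k. t \<le> ?T (Suc k)"] by (simp add: k_def)
    then show ?thesis using Suc by simp
  qed
  then show ?thesis
    using le zigzag_vec_eq_plus_slope[OF pos, of "?T k" t]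
    by (simp add: billiard_curve_def Let_def bounce_state_eq[OF pos] bounce_time_Suc[OF pos]
        flip: k_def[unfolded bounce_time_Suc[OF pos]])
qed

section \<open>Stopping time and common unit\<close>

text \<open>With c = g this describes the times at corners, with c = 2 g the times at the
  origin.\<close>

lemma multiple_of_all_iff:
  fixes p :: "'a \<Rightarrow> int" and c s :: real
  assumes c: "c \<noteq> 0"
  shows "(\<forall>i. \<exists>k::int. s = of_int k * (c * of_int (p i))) \<longleftrightarrow>
    (\<exists>k::int. s = of_int k * (c * of_int (Lcm (range p))))"
proof
  assume all: "\<forall>i. \<exists>k::int. s = of_int k * (c * of_int (p i))"
  then obtain k :: "'a \<Rightarrow> int" where k: "\<And>i. s = of_int (k i) * (c * of_int (p i))"
    by metis
  define x where "x = k undefined * p undefined"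
  have x: "s = c * of_int x" using k[of undefined] by (simp add: x_def)
  have "p i dvd x" for i
  proof -
    have "c * of_int x = c * of_int (k i * p i)" using k[of i] x by simp
    then have "x = k i * p i" using c by (metis mult_left_cancel of_int_eq_iff)
    then show ?thesis by simp
  qed
  then have "Lcm (range p) dvd x" by (auto intro: Lcm_least)
  then obtain l where "x = Lcm (range p) * l" ..
  then show "\<exists>k::int. s = of_int k * (c * of_int (Lcm (range p)))"
    using x by (intro exI[of _ l]) simp
next
  assume "\<exists>k::int. s = of_int k * (c * of_int (Lcm (range p)))"
  then obtain k :: int where k: "s = of_int k * (c * of_int (Lcm (range p)))" ..
  show "\<forall>i. \<exists>k::int. s = of_int k * (c * of_int (p i))"
  proof
    fix i
    have "p i dvd Lcm (range p)" by (simp add: dvd_Lcm)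
    then obtain l where "Lcm (range p) = p i * l" ..
    then show "\<exists>k::int. s = of_int k * (c * of_int (p i))"
      using k by (intro exI[of _ "k * l"]) simp
  qed
qed

text \<open>Corners occur at the multiples of \<open>L\<close> and the origin at the multiples of 2
  L. So the first corner other than the origin is met at \<open>L\<close>, by parity.\<close>

lemma trajectory_domain_eq:
  fixes a :: "real ^ 'n" and p :: "'n \<Rightarrow> int"
  assumes g: "g > 0" and p: "\<And>i. p i > 0" and a: "\<And>i. a $ i = g * of_int (p i)"
  shows "trajectory_domain a = {0..g * of_int (Lcm (range p))}"
proof -
  define L where "L = g * of_int (Lcm (range p))"
  have pos: "a $ i > 0" for i using g p a by simp
  have L: "L > 0" using g Lcm_range_pos[of p] p by (simp add: L_def)
  have corner: "corner a (zigzag_vec a s) \<longleftrightarrow> (\<exists>k::int. s = of_int k * L)" for s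
    using multiple_of_all_iff[of g s p] g pos
    by (simp only: corner_def zigzag_vec_def vec_lambda_beta zigzag_at_end_iff a L_def)
  have zero: "zigzag_vec a s = 0 \<longleftrightarrow> (\<exists>k::int. s = of_int k * (2 * L))" for s
    using multiple_of_all_iff[of "2 * g" s p] g
    by (simp add: vec_eq_iff zigzag_vec_def zigzag_eq_0_iff[OF pos, unfolded a] a L_def mult.assoc)
  have stop: "corner a (zigzag_vec a L) \<and> zigzag_vec a L \<noteq> 0"
  proof
    show "corner a (zigzag_vec a L)" unfolding corner by (rule exI[of _ 1]) simp
    show "zigzag_vec a L \<noteq> 0"
    proof
      assume "zigzag_vec a L = 0"
      then obtain k :: int where "L = of_int k * (2 * L)" unfolding zero ..
      then have "(1::real) = of_int (2 * k)" using L by simp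
      then have "1 = 2 * k" by linarith
      then show False by presburger
    qed
  qed
  have before: "zigzag_vec a s = 0" if s: "0 \<le> s" "s < L" "corner a (zigzag_vec a s)" for s
  proof -
    obtain k :: int where k: "s = of_int k * L" using s corner by blast
    have "0 \<le> of_int k * L" "of_int k * L < 1 * L" using s k by simp_all
    then have "0 \<le> k" "k < 1" using L by (simp_all only: mult_less_cancel_right_pos zero_le_mult_iff) auto
    then have "k = 0" by simp
    then show ?thesis unfolding zero using k by (intro exI[of _ 0]) simp
  qed
  have curve: "billiard_curve a s = zigzag_vec a s" if "0 \<le> s" for s
    using billiard_curve_eq_zigzag[OF g p a that] .
  show ?thesis
    unfolding L_def[symmetric]
  proof (intro set_eqI iffI)
    fix t assume t: "t \<in> trajectory_domain a"
    have "\<not> L < t"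
      using t stop L curve[of L] unfolding trajectory_domain_def mem_Collect_eq
      by (metis less_imp_le)
    then show "t \<in> {0..L}" using t by (simp add: trajectory_domain_def)
  next
    fix t assume "t \<in> {0..L}"
    then show "t \<in> trajectory_domain a"
      using before by (auto simp: trajectory_domain_def curve)
  qed
qed

lemma commensurable_common_unit:
  fixes a :: "'a::finite \<Rightarrow> real"
  assumes pos: "\<And>i. a i > 0" and rat: "\<And>i j. a i / a j \<in> \<rat>"
  shows "\<exists>g p. g > 0 \<and> (\<forall>i. p i > (0::int) \<and> a i = g * of_int (p i))"
proof -
  define b where "b = a undefined"
  have b: "b > 0" using pos by (simp add: b_def)
  have "\<exists>u n. n \<noteq> 0 \<and> a i / b = of_int u / of_nat n" for i
    using rat[of i undefined] by (auto simp: Rats_eq_int_div_nat b_def)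
  then obtain u :: "'a \<Rightarrow> int" and n :: "'a \<Rightarrow> nat"
    where un: "\<And>i. n i \<noteq> 0" "\<And>i. a i / b = of_int (u i) / of_nat (n i)" by metis
  \<comment> \<open>The product serves as common denominator of the ratios a_i / b;
    \<open>p i\<close> is the numerator after expanding to it.\<close>
  define g where "g = b / of_nat (\<Prod>k\<in>UNIV. n k)"
  define p where "p i = u i * int (\<Prod>k\<in>UNIV - {i}. n k)" for i
  have g: "g > 0" using b un(1) by (simp add: g_def prod_pos)
  have eq: "a i = g * of_int (p i)" for i
  proof -
    define N where "N = (\<Prod>k\<in>UNIV - {i}. n k)"
    have prod: "(\<Prod>k\<in>UNIV. n k) = n i * N" unfolding N_def by (rule prod.remove) auto
    have N: "N \<noteq> 0" using un(1) by (simp add: N_def)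
    have "g * of_int (p i) = b / of_nat (n i * N) * of_int (u i * int N)"
      by (simp only: g_def p_def prod N_def)
    also have "\<dots> = b * (of_int (u i) / of_nat (n i))"
      using un(1)[of i] N by simp
    also have "\<dots> = a i" using b by (simp flip: un(2))
    finally show ?thesis ..
  qed
  have "p i > 0" for i using pos[of i] g by (simp add: eq zero_less_mult_iff)
  then show ?thesis using g eq by blast
qed

section \<open>Level sets and crossing numbers\<close>

lemma card_zigzag_level_set_power_of_2:
  fixes a :: "real ^ 'n" and p :: "'n \<Rightarrow> int"
  assumes g: "g > 0" and p: "\<And>i. p i > 0" and a: "\<And>i. a $ i = g * of_int (p i)"
    and t0: "t0 \<in> {0..g * of_int (Lcm (range p))}"
  shows "\<exists>k. card {t \<in> {0..g * of_int (Lcm (range p))}. zigzag_vec a t = zigzag_vec a t0} = 2 ^ k"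
proof -
  define P where "P = Lcm (range p)"
  define S where "S = {t \<in> {0..g * of_int P}. zigzag_vec a t = zigzag_vec a t0}"
  have pos: "a $ i > 0" for i using g p a by simp
  have level: "zigzag_vec a t = zigzag_vec a t0 \<longleftrightarrow>
      (\<forall>i. \<exists>k::int. t - t0 = of_int k * (2 * g * of_int (p i)) \<or> t + t0 = of_int k * (2 * g * of_int (p i)))"
    for t
    by (simp add: vec_eq_iff zigzag_vec_def zigzag_eq_iff[OF pos, unfolded a] a mult.assoc)
  have "\<exists>k. card S = 2 ^ k"
  proof (cases "\<exists>m::int. t0 = g * of_int m")
    case True
    then obtain m :: int where m: "t0 = g * of_int m" ..
    have mP: "m \<in> {0..Lcm (range p)}"
      using t0 g by (simp add: m zero_le_mult_iff)
    define Z where "Z = {x \<in> {0..P}. \<forall>i. 2 * p i dvd x - m \<or> 2 * p i dvd x + m}"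
    have unit: "g * of_int y = of_int k * (2 * g * of_int (p i)) \<longleftrightarrow> y = 2 * p i * k" for y k i
    proof -
      have "of_int k * (2 * g * of_int (p i)) = g * of_int (2 * p i * k)" by simp
      then show ?thesis using g by (simp only: mult_cancel_left of_int_eq_iff) simp
    qed
    have level_int: "zigzag_vec a (g * of_int x) = zigzag_vec a t0 \<longleftrightarrow>
        (\<forall>i. 2 * p i dvd x - m \<or> 2 * p i dvd x + m)" for x
    proof -
      have "g * of_int x - t0 = g * of_int (x - m)" "g * of_int x + t0 = g * of_int (x + m)"
        by (simp_all add: m algebra_simps)
      then show ?thesis unfolding level by (simp only: unit dvd_def) blast
    qed
    have "S = (\<lambda>x. g * of_int x) ` Z"
    proof (intro set_eqI iffI)
      fix t assume t: "t \<in> S"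
      \<comment> \<open>One coordinate, chosen arbitrarily, already shows that \<open>t\<close> is a
        multiple of \<open>g\<close>.\<close>
      then obtain k :: int where
        "t - t0 = of_int k * (2 * g * of_int (p undefined)) \<or> t + t0 = of_int k * (2 * g * of_int (p undefined))"
        unfolding S_def level by blast
      then have "t = g * of_int (m + 2 * p undefined * k) \<or> t = g * of_int (2 * p undefined * k - m)"
        by (auto simp: m algebra_simps)
      then obtain x :: int where x: "t = g * of_int x" by blast
      then have "x \<in> Z" using t level_int g by (simp add: S_def Z_def zero_le_mult_iff)
      then show "t \<in> (\<lambda>x. g * of_int x) ` Z" using x by blast
    qed (use level_int g in \<open>auto simp: S_def Z_def\<close>)
    then have "card S = card Z" using g by (simp add: card_image inj_on_def)
    then show ?thesis
      using card_half_solutions_power_of_2[OF p mP] by (simp add: Z_def P_def)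
  next
    case False
    have "t = t0" if t: "t \<in> S" for t
    proof -
      define D where "D i s \<longleftrightarrow> (\<exists>k::int. s = of_int k * (2 * g * of_int (p i)))" for i s
      have D: "D i (t - t0) \<or> D i (t + t0)" for i
        using t unfolding S_def level D_def by blast
      have "\<not> (D i (t + t0) \<and> D j (t - t0))" for i j
      proof
        assume "D i (t + t0) \<and> D j (t - t0)"
        then obtain k l :: int where "t + t0 = of_int k * (2 * g * of_int (p i))"
            "t - t0 = of_int l * (2 * g * of_int (p j))" unfolding D_def by blast
        \<comment> \<open>Subtract and halve: as both moduli are multiples of 2 g, mixed signs would
          make \<open>t0\<close> itself a multiple of \<open>g\<close>.\<close>
        then have "t0 = g * of_int (k * p i - l * p j)" by (simp add: algebra_simps)
        then show False using False by blast
      qed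
      with D have "(\<forall>i. D i (t - t0)) \<or> (\<forall>i. D i (t + t0))" by blast
      then have "(\<exists>k::int. t - t0 = of_int k * (2 * g * of_int P)) \<or>
          (\<exists>k::int. t + t0 = of_int k * (2 * g * of_int P))"
        using g unfolding D_def P_def by (simp add: multiple_of_all_iff)
      moreover define L where "L = g * of_int P"
      moreover have L: "L > 0" using g p Lcm_range_pos[of p] by (simp add: L_def P_def)
      ultimately consider (minus) k :: int where "t - t0 = of_int k * (2 * L)"
        | (plus) k :: int where "t + t0 = of_int k * (2 * L)" by (auto simp: mult.assoc)
      then show ?thesis
      proof cases
        case minus
        have "\<bar>of_int k * (2 * L)\<bar> \<le> L" 
          using t t0 unfolding minus[symmetric] by (auto simp: S_def L_def P_def)
        then have "\<bar>of_int k\<bar> * 2 \<le> (1::real)" using L by (simp add: abs_mult)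
        then have "k = 0" by linarith
        then show ?thesis using minus by simp
      next
        case plus
        have range: "0 \<le> t" "t \<le> L" "0 \<le> t0" "t0 \<le> L" using t t0 by (simp_all add: S_def L_def P_def)
        then have "0 \<le> of_int k * (2 * L)" "of_int k * (2 * L) \<le> 1 * (2 * L)" using plus by linarith+
        then have "0 \<le> k" "k \<le> 1" using L by (simp_all add: zero_le_mult_iff del: mult_1)
        \<comment> \<open>Both times are 0 or both are \<open>L\<close>, so they coincide here
          too.\<close>
        then have "k = 0 \<or> k = 1" by linarith
        then show ?thesis using range plus by auto
      qed
    qed
    moreover have "t0 \<in> S" using t0 by (simp add: S_def P_def)
    ultimately have "S = {t0}" by blast
    then show ?thesis by (intro exI[of _ 0]) simp
  qed
  then show ?thesis by (simp add: S_def P_def)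
qed

theorem theorem1:
  fixes a v :: "real ^ 'n"
  assumes "\<forall>i. a $ i > 0"
    and "\<forall>i j. a $ i / a $ j \<in> \<rat>"
    and "v \<in> cbox 0 a"
  shows "crossing_number a v \<in> {0} \<union> {2 ^ k | k :: nat. True}"
proof -
  have pos: "\<And>i. a $ i > 0" and rat: "\<And>i j. a $ i / a $ j \<in> \<rat>" using assms by auto
  obtain g p where g: "g > 0" and p: "\<And>i. p i > (0::int)" and a: "\<And>i. a $ i = g * of_int (p i)"
    using commensurable_common_unit[of "\<lambda>i. a $ i", OF pos rat] by blast
  let ?I = "{0..g * of_int (Lcm (range p))}"
  have "{t \<in> trajectory_domain a. billiard_curve a t = v} = {t \<in> ?I. zigzag_vec a t = v}" (is "?P = ?S")
    using billiard_curve_eq_zigzag[OF g p a] by (auto simp: trajectory_domain_eq[OF g p a])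
  \<comment> \<open>A nonempty \<open>?S\<close> is the level set through any of its own members,
    taken as \<open>t0\<close>.\<close>
  moreover have "?S = {} \<or> (\<exists>k. card ?S = 2 ^ k)"
    using card_zigzag_level_set_power_of_2[OF g p a] by blast
  ultimately consider "?P = {}" | k where "card ?P = 2 ^ k" by auto
  then show ?thesis
  proof cases
    case 1
    then show ?thesis unfolding crossing_number_def Let_def by (simp only:) (simp add: zero_enat_def)
  next
    case 2
    \<comment> \<open>Infinite sets have \<open>card\<close> 0, which is not a power of two.\<close>
    then have "finite ?P" by (metis card.infinite power_not_zero zero_neq_numeral)
    moreover have "enat (2 ^ k) = 2 ^ k" by (simp flip: of_nat_eq_enat)
    ultimately show ?thesis using 2 unfolding crossing_number_def Let_def by auto
  qed
qed

end
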